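(* There is no algorithm that, given an $n$-vertex graph $G$ and an integer-valued monotone submodular function $f\colon 2^{V(G)}\rightarrow \mathbb{Z}_{\ge 0}$ represented by a value oracle, on instances with ${\sf OPT}=\mathcal{O}(n)$, computes a cycle $C$ of $G$ with $f(V(C))\le {\sf OPT}$ using at most $n^{o(\log n)}$ queries to the oracle.
   Context: A function $f\colon 2^U\to\mathbb{R}$ is submodular if $f(X)+f(Y)\ge f(X\cup Y)+f(X\cap Y)$ for all $X,Y\subseteq U$, and monotone if $f(X)\le f(Y)$ whenever $X\subseteq Y$. The function is accessible only via a value oracle returning $f(X)$ on query $X$. ${\sf OPT}=\min\{f(V(C))\colon C \text{ is a cycle of } G\}$. *)

theory Defs
  imports Complex_Main "HOL-Library.Landau_Symbols"
begin

text \<open>Finite simple undirected graphs: a vertex set together with a set of two-element edges.\<close>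

type_synonym 'v graph = "'v set \<times> 'v set set"

abbreviation verts :: "'v graph \<Rightarrow> 'v set" where
  "verts G \<equiv> fst G"

abbreviation edges :: "'v graph \<Rightarrow> 'v set set" where
  "edges G \<equiv> snd G"

definition is_graph :: "'v graph \<Rightarrow> bool" where
  "is_graph G \<longleftrightarrow>
     finite (verts G) \<and> (\<forall>e \<in> edges G. e \<subseteq> verts G \<and> card e = 2)"

text \<open>A cycle is given by the list of its vertices in cyclic order, so that its vertex set is
  \<open>set C\<close>; the reduction modulo \<open>length C\<close> supplies the closing edge.\<close>

definition is_cycle :: "'v graph \<Rightarrow> 'v list \<Rightarrow> bool" where
  "is_cycle G C \<longleftrightarrow>
     3 \<le> length C \<and> distinct C \<and> set C \<subseteq> verts G \<and>
     (\<forall>i < length C. {C ! i, C ! (Suc i mod length C)} \<in> edges G)"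

definition submodular_on :: "'v set \<Rightarrow> ('v set \<Rightarrow> 'b::{plus,ord}) \<Rightarrow> bool" where
  "submodular_on U f \<longleftrightarrow>
     (\<forall>X Y. X \<subseteq> U \<longrightarrow> Y \<subseteq> U \<longrightarrow> f X + f Y \<ge> f (X \<union> Y) + f (X \<inter> Y))"

text \<open>Meaningful only if \<open>G\<close> is a graph that has a cycle: the set is then finite and nonempty.\<close>

definition OPT :: "'v graph \<Rightarrow> ('v set \<Rightarrow> nat) \<Rightarrow> nat" where
  "OPT G f = Min {f (set C) | C. is_cycle G C}"

text \<open>An instance is a graph with at least one cycle and a monotone submodular function with values
  in the nonnegative integers. The function is constrained only on subsets of the vertex set.\<close>

definition is_instance :: "'v graph \<Rightarrow> ('v set \<Rightarrow> nat) \<Rightarrow> bool" where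
  "is_instance G f \<longleftrightarrow>
     is_graph G \<and> (\<exists>C. is_cycle G C) \<and>
     mono_on (Pow (verts G)) f \<and> submodular_on (verts G) f"

text \<open>A deterministic oracle algorithm is an adaptive strategy: from the graph and the list of
  queries asked so far with their answers it determines the next query or the output. Internal
  computation is unrestricted, so every deterministic algorithm in a machine model with a value
  oracle induces such a strategy. Nothing forces a strategy to terminate.\<close>

datatype 'v action = Query "'v set" | Output "'v list"

type_synonym 'v algorithm = "'v graph \<Rightarrow> ('v set \<times> nat) list \<Rightarrow> 'v action"

text \<open>\<open>run A G f h k C\<close>: started with history \<open>h\<close>, the algorithm \<open>A\<close> on \<open>G\<close> with value oracle \<open>f\<close>
  asks exactly \<open>k\<close> further queries and then outputs \<open>C\<close>. The oracle answers only queries that are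
  subsets of the vertex set; a run with any other query has no result.\<close>

inductive run ::
  "'v algorithm \<Rightarrow> 'v graph \<Rightarrow> ('v set \<Rightarrow> nat) \<Rightarrow> ('v set \<times> nat) list \<Rightarrow> nat \<Rightarrow> 'v list \<Rightarrow> bool"
  for A G f where
  finish: "A G h = Output C \<Longrightarrow> run A G f h 0 C"
| ask: "A G h = Query X \<Longrightarrow> X \<subseteq> verts G \<Longrightarrow> run A G f (h @ [(X, f X)]) k C
            \<Longrightarrow> run A G f h (Suc k) C"

text \<open>On every instance with \<open>OPT G f \<le> c * n\<close>, where \<open>n\<close> is the number of vertices, the algorithm
  outputs an optimal cycle after at most \<open>q n\<close> queries. There is no requirement on other inputs.\<close>

definition solves_min_cycle :: "'v algorithm \<Rightarrow> real \<Rightarrow> (nat \<Rightarrow> real) \<Rightarrow> bool" where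
  "solves_min_cycle A c q \<longleftrightarrow>
     (\<forall>G f. is_instance G f \<and> real (OPT G f) \<le> c * real (card (verts G)) \<longrightarrow>
        (\<exists>k C. run A G f [] k C \<and> real k \<le> q (card (verts G)) \<and>
               is_cycle G C \<and> f (set C) \<le> OPT G f))"

end

theory Submission
  imports Defs "HOL-Library.FuncSet"
begin

text \<open>Let \<open>G\<close> be the blow-up of a ring of \<open>L\<close> blocks, each an independent set of \<open>3 ^ L\<close> vertices.
  A cycle of \<open>G\<close> either meets some block twice or is a transversal of the blocks. The function
  \<open>3 ^ L - \<Prod>i. w\<^sub>i\<close>, where \<open>w\<^sub>i\<close> is \<open>3\<close>, \<open>1\<close> or \<open>0\<close> if the set meets block \<open>i\<close> in no, one or more
  vertices, is monotone and submodular; it equals \<open>3 ^ L\<close> on cycles of the first kind and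
  \<open>3 ^ L - 1\<close> on transversals. Because \<open>3, 1, 0\<close> is strictly convex, the value of a single
  transversal can be lowered by one without destroying submodularity. A query reveals the lowered
  transversal only if it asks for exactly that set, and there are \<open>3 ^ (L * L)\<close> transversals,
  which is \<open>n\<close> to a power of order \<open>ln n\<close> for \<open>n = L * 3 ^ L\<close>.\<close>

section \<open>Oracle runs\<close>

lemma run_deterministic:
  assumes "run A G f h k C" "run A G f h k' C'"
  shows "C = C'"
  using assms
proof (induction arbitrary: k' rule: run.induct)
  case (finish h C)
  from finish(2) show ?case by cases (use finish in auto)
next
  case (ask h X k C)
  from ask(5) show ?case by cases (use ask in auto)
qed

text \<open>\<open>Q\<close> collects the sets queried along the run: an oracle with the same
  answers there produces the same histories, hence the same actions.\<close>

lemma run_depends_on_few_values: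
  assumes "run A G f h k C"
  shows "\<exists>Q. finite Q \<and> card Q \<le> k \<and>
    (\<forall>f'. (\<forall>X\<in>Q. f' X = f X) \<longrightarrow> run A G f' h k C)"
  using assms
proof (induction rule: run.induct)
  case (finish h C)
  then show ?case by (intro exI[of _ "{}"]) (auto intro: run.finish)
next
  case (ask h X k C)
  then obtain Q where Q: "finite Q" "card Q \<le> k"
    "\<forall>f'. (\<forall>X\<in>Q. f' X = f X) \<longrightarrow> run A G f' (h @ [(X, f X)]) k C"
    by blast
  have "card (insert X Q) \<le> Suc k"
    using Q by (simp add: card_insert_if)
  moreover have "run A G f' h (Suc k) C" if "\<forall>Y\<in>insert X Q. f' Y = f Y" for f'
    using that Q(3) ask(1,2) by (intro run.ask[of A G h X]) auto
  ultimately show ?case using Q(1) by (intro exI[of _ "insert X Q"]) auto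
qed

section \<open>Submodular functions of block profiles\<close>

text \<open>The drops 2, 1, 0 make the sequence convex. With 2 in place of 3, exchanging one vertex
  of a transversal would leave too little room for the hidden unit.\<close>

definition res :: "nat \<Rightarrow> nat" where
  "res j = (if j = 0 then 3 else if j = 1 then 1 else 0)"

definition slack :: "('v \<Rightarrow> 'i) \<Rightarrow> 'i set \<Rightarrow> 'v set \<Rightarrow> nat" where
  "slack b I X = (\<Prod>i\<in>I. res (card {x \<in> X. b x = i}))"

definition hidden_slack :: "('v \<Rightarrow> 'i) \<Rightarrow> 'i set \<Rightarrow> 'v set \<Rightarrow> 'v set \<Rightarrow> nat" where
  "hidden_slack b I S X = slack b I X + (if X = S then 1 else 0)"

lemma res_antimono: "j \<le> k \<Longrightarrow> res k \<le> res j"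
  by (auto simp: res_def)

lemma res_convex: "p + q = j + k \<Longrightarrow> p \<le> j \<Longrightarrow> p \<le> k \<Longrightarrow> res j + res k \<le> res q + res p"
  by (auto simp: res_def)

lemma slack_antimono:
  assumes "finite Y" "X \<subseteq> Y"
  shows "slack b I Y \<le> slack b I X"
  unfolding slack_def using assms
  by (intro prod_mono conjI res_antimono card_mono) auto

lemma slack_le: "slack b I X \<le> 3 ^ card I"
  unfolding slack_def by (rule prod_le_power) (auto simp: res_def)

text \<open>Makes products of nonnegative antitone supermodular functions supermodular, with
  \<open>a\<close> at the intersection and \<open>d\<close> at the union. Writing
  \<open>b = d + u\<close>, \<open>c = d + v\<close>, and likewise with primes, the surplus is at
  least \<open>u * v' + v * u'\<close>.\<close>

lemma supermodular_mult:
  fixes a b c d a' b' c' d' :: nat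
  assumes "d \<le> b" "d \<le> c" "b + c \<le> d + a" "d' \<le> b'" "d' \<le> c'" "b' + c' \<le> d' + a'"
  shows "b * b' + c * c' \<le> d * d' + a * a'"
proof -
  obtain u v where uv: "b = d + u" "c = d + v"
    using assms by (metis le_Suc_ex)
  obtain u' v' where uv': "b' = d' + u'" "c' = d' + v'"
    using assms by (metis le_Suc_ex)
  have "(d + u + v) * (d' + u' + v') \<le> a * a'"
    using assms uv uv' by (intro mult_mono) auto
  then show ?thesis by (simp add: uv uv' algebra_simps)
qed

text \<open>The number of points in a block is modular, so convexity of \<open>res\<close> makes
  each factor supermodular; all factors are antitone, so the product inherits this block by
  block.\<close>

lemma slack_supermodular:
  assumes "finite X" "finite Y" "finite I"
  shows "slack b I X + slack b I Y \<le> slack b I (X \<union> Y) + slack b I (X \<inter> Y)"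
  using assms(3)
proof (induction I)
  case empty
  show ?case by (simp add: slack_def)
next
  case (insert i I)
  let ?c = "\<lambda>Z. card {x \<in> Z. b x = i}"
  have split: "slack b (insert i I) Z = res (?c Z) * slack b I Z" for Z
    using insert by (simp add: slack_def)
  have "{x \<in> X \<union> Y. b x = i} = {x \<in> X. b x = i} \<union> {x \<in> Y. b x = i}"
    "{x \<in> X \<inter> Y. b x = i} = {x \<in> X. b x = i} \<inter> {x \<in> Y. b x = i}" by auto
  then have "?c (X \<inter> Y) + ?c (X \<union> Y) = ?c X + ?c Y"
    using assms card_Un_Int[of "{x \<in> X. b x = i}" "{x \<in> Y. b x = i}"] by simp
  moreover have "?c (X \<inter> Y) \<le> ?c X" "?c (X \<inter> Y) \<le> ?c Y" "?c X \<le> ?c (X \<union> Y)" "?c Y \<le> ?c (X \<union> Y)"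
    using assms by (auto intro!: card_mono)
  ultimately show ?case
    unfolding split using insert.IH assms
    by (intro supermodular_mult res_convex res_antimono slack_antimono) auto
qed

section \<open>Transversals and their subsets\<close>

lemma block_card_transversal:
  assumes "bij_betw b S I" "A \<subseteq> S"
  shows "card {x \<in> A. b x = i} = (if i \<in> b ` A then 1 else 0)"
proof (cases "i \<in> b ` A")
  case True
  then obtain x where "x \<in> A" "b x = i" by auto
  then have "{y \<in> A. b y = i} = {x}"
    using assms by (auto simp: bij_betw_def dest: inj_onD)
  with True show ?thesis by simp
next
  case False
  then have "{x \<in> A. b x = i} = {}" by auto
  with False show ?thesis by (simp only: card.empty if_False)
qed

lemma slack_transversal:
  assumes "bij_betw b S I"
  shows "slack b I S = 1"
proof -
  have "b ` S = I" using assms by (simp add: bij_betw_def)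
  then show ?thesis
    unfolding slack_def using block_card_transversal[OF assms order_refl]
    by (auto simp: res_def intro!: prod.neutral)
qed

lemma slack_remove:
  assumes "finite I" "i \<in> I"
  shows "slack b I X = res (card {x \<in> X. b x = i}) * slack b (I - {i}) X"
  using assms by (simp add: slack_def prod.remove)

text \<open>A subset of a transversal meets each block at most once, so no factor vanishes.\<close>

lemma slack_pos:
  assumes "bij_betw b S I" "A \<subseteq> S"
  shows "1 \<le> slack b J A"
  unfolding slack_def using block_card_transversal[OF assms]
  by (intro prod_ge_1) (auto simp: res_def)

text \<open>A missing vertex leaves its block empty, which contributes a factor 3; the other factors
  are at least 1.\<close>

lemma slack_psubset:
  assumes "finite I" "bij_betw b S I" "A \<subset> S"
  shows "3 \<le> slack b I A"
proof -
  obtain s where s: "s \<in> S" "s \<notin> A" using assms(3) by auto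
  have "b s \<in> I" using assms(2) s by (auto simp: bij_betw_def)
  moreover have "b s \<notin> b ` A"
    using assms(2,3) s by (auto simp: bij_betw_def dest: inj_onD)
  then have "card {x \<in> A. b x = b s} = 0"
    using block_card_transversal[OF assms(2), of A "b s"] assms(3) by auto
  ultimately show ?thesis
    using slack_remove[OF assms(1), of "b s" b A] slack_pos[OF assms(2), of A "I - {b s}"] assms(3)
    by (simp add: res_def)
qed

text \<open>The strict form of supermodularity that pays for lowering the value of a transversal.\<close>

lemma slack_gap:
  assumes "finite I" "bij_betw b S I" "finite Y" "S \<inter> Y \<noteq> S" "y \<in> Y" "y \<notin> S" "b y \<in> I"
  shows "slack b I Y + 2 \<le> slack b I (S \<inter> Y)"
proof -
  let ?A = "S \<inter> Y" and ?i = "b y"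
  have three: "3 \<le> slack b I ?A"
    using assms by (intro slack_psubset) auto
  have "{x \<in> ?A. b x = ?i} \<subset> {x \<in> Y. b x = ?i}" using assms by auto
  then have less: "card {x \<in> ?A. b x = ?i} < card {x \<in> Y. b x = ?i}"
    using assms by (intro psubset_card_mono) auto
  have rest: "slack b (I - {?i}) Y \<le> slack b (I - {?i}) ?A"
    using assms by (intro slack_antimono) auto
  show ?thesis
  proof (cases "?i \<in> b ` ?A")
    case True
    then have "card {x \<in> ?A. b x = ?i} = 1"
      using block_card_transversal[OF assms(2), of ?A ?i] by auto
    \<comment> \<open>The vertex \<open>y\<close> is a second one in its block, so this factor is 0
      for \<open>Y\<close>.\<close>
    then have "slack b I Y = 0"
      using slack_remove[OF assms(1,7), of b Y] less by (simp add: res_def)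
    with three show ?thesis by simp
  next
    case False
    then have "card {x \<in> ?A. b x = ?i} = 0"
      using block_card_transversal[OF assms(2), of ?A ?i] by auto
    \<comment> \<open>Adding \<open>y\<close> lowers the factor of this block from 3 to at most 1.
      The other factors have a product r \<ge> 1 on \<open>S \<inter> Y\<close>, and r + 2 \<le> 3
      r.\<close>
    then have "slack b I ?A = 3 * slack b (I - {?i}) ?A"
      using slack_remove[OF assms(1,7), of b ?A] by (simp add: res_def)
    moreover have "slack b I Y \<le> 1 * slack b (I - {?i}) Y"
      unfolding slack_remove[OF assms(1,7), of b Y]
      using less by (intro mult_right_mono) (auto simp: res_def)
    moreover have "1 \<le> slack b (I - {?i}) ?A"
      using slack_pos[OF assms(2), of ?A] by simp
    ultimately show ?thesis using rest by linarith
  qed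
qed

section \<open>Hiding one transversal\<close>

text \<open>Only passing from a proper subset to \<open>S\<close> itself could fail: there the
  raised value 2 is still below 3.\<close>

lemma hidden_slack_antimono:
  assumes "finite I" "bij_betw b S I" "finite Y" "X \<subseteq> Y"
  shows "hidden_slack b I S Y \<le> hidden_slack b I S X"
proof (cases "Y = S \<and> X \<noteq> S")
  case True
  then have "3 \<le> slack b I X" using assms by (intro slack_psubset) auto
  with True slack_transversal[OF assms(2)] show ?thesis by (simp add: hidden_slack_def)
next
  case False
  with slack_antimono[OF assms(3,4), of b I] show ?thesis by (auto simp: hidden_slack_def)
qed

text \<open>Comparable sets give equality, and if neither set is \<open>S\<close> the extra unit can
  only help. If one is \<open>S\<close> and the other an incomparable \<open>Y\<close>, the left
  side is \<open>slack b I Y + 2\<close>, which \<open>slack_gap\<close> bounds by the value at the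
  intersection alone.\<close>

lemma hidden_slack_supermodular:
  assumes "finite I" "bij_betw b S I" "finite X" "finite Y" "b ` X \<subseteq> I" "b ` Y \<subseteq> I"
  shows "hidden_slack b I S X + hidden_slack b I S Y
           \<le> hidden_slack b I S (X \<union> Y) + hidden_slack b I S (X \<inter> Y)"
proof -
  have *: "hidden_slack b I S S + hidden_slack b I S Y
           \<le> hidden_slack b I S (S \<union> Y) + hidden_slack b I S (S \<inter> Y)"
    if Y: "\<not> S \<subseteq> Y" "\<not> Y \<subseteq> S" "finite Y" "b ` Y \<subseteq> I" for Y
  proof -
    obtain y where "y \<in> Y" "y \<notin> S" using Y by auto
    then have "slack b I Y + 2 \<le> slack b I (S \<inter> Y)"
      using assms that by (intro slack_gap) auto
    then show ?thesis
      using slack_transversal[OF assms(2)] that by (auto simp: hidden_slack_def)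
  qed
  consider "X \<subseteq> Y" | "Y \<subseteq> X" | "\<not> X \<subseteq> Y" "\<not> Y \<subseteq> X" by blast
  then show ?thesis
  proof cases
    case 1
    then have "X \<union> Y = Y" "X \<inter> Y = X" by auto
    then show ?thesis by simp
  next
    case 2
    then have "X \<union> Y = X" "X \<inter> Y = Y" by auto
    then show ?thesis by simp
  next
    case 3
    consider "X = S" | "Y = S" | "X \<noteq> S" "Y \<noteq> S" by blast
    then show ?thesis
    proof cases
      case 1
      with 3 assms show ?thesis using *[of Y] by simp
    next
      case 2
      with 3 assms show ?thesis using *[of X] by (simp add: Un_commute Int_commute)
    next
      case 3
      with slack_supermodular[OF assms(3,4,1), of b] show ?thesis
        by (simp add: hidden_slack_def)
    qed
  qed
qed

lemma hidden_slack_le: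
  assumes "finite I" "I \<noteq> {}" "bij_betw b S I"
  shows "hidden_slack b I S X \<le> 3 ^ card I"
proof (cases "X = S")
  case True
  have "(3::nat) ^ 1 \<le> 3 ^ card I"
    using assms by (intro power_increasing) (auto simp: card_gt_0_iff Suc_le_eq)
  with True slack_transversal[OF assms(3)] show ?thesis by (simp add: hidden_slack_def)
qed (use slack_le in \<open>simp add: hidden_slack_def\<close>)

text \<open>The bound \<open>M\<close> keeps the truncated subtraction exact, so complementing
  reverses the inequality.\<close>

lemma submodular_on_diff:
  fixes F :: "'v set \<Rightarrow> nat"
  assumes "\<And>X. F X \<le> M"
    "\<And>X Y. X \<subseteq> U \<Longrightarrow> Y \<subseteq> U \<Longrightarrow> F X + F Y \<le> F (X \<union> Y) + F (X \<inter> Y)"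
  shows "submodular_on U (\<lambda>X. M - F X)"
  unfolding submodular_on_def
proof (intro allI impI)
  fix X Y assume "X \<subseteq> U" "Y \<subseteq> U"
  then show "M - F X + (M - F Y) \<ge> M - F (X \<union> Y) + (M - F (X \<inter> Y))"
    using assms(2)[of X Y] assms(1)[of X] assms(1)[of Y] assms(1)[of "X \<union> Y"] assms(1)[of "X \<inter> Y"]
    by linarith
qed

section \<open>The blown-up ring\<close>

text \<open>The residue modulo \<open>L\<close> encodes the block: \<open>i + L * j\<close> with
  \<open>i < L\<close> and \<open>j < m\<close> is copy \<open>j\<close> of ring position
  \<open>i\<close>.\<close>

definition ring_graph :: "nat \<Rightarrow> nat \<Rightarrow> nat graph" where
  "ring_graph L m = ({..<L * m},
     {{u, v} | u v. u < L * m \<and> v < L * m \<and> v mod L = Suc u mod L})"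

definition block :: "nat \<Rightarrow> nat \<Rightarrow> nat" where
  "block L v = v mod L"

lemma Suc_mod_neq:
  assumes "2 \<le> L"
  shows "Suc u mod L \<noteq> u mod L"
  using assms by (simp add: mod_Suc)

lemma Suc_mod_inject:
  assumes "Suc u mod L = Suc v mod L"
  shows "u mod L = v mod L"
  using assms by (auto simp: mod_Suc split: if_splits)

lemma is_graph_ring_graph:
  assumes "2 \<le> L"
  shows "is_graph (ring_graph L m)"
proof -
  have "card {u, v} = 2" if "v mod L = Suc u mod L" for u v
    using that Suc_mod_neq[OF assms] by (metis card_2_iff)
  then show ?thesis unfolding is_graph_def ring_graph_def by auto
qed

lemma ring_edge_cases:
  assumes "{u, v} \<in> edges (ring_graph L m)"
  shows "v mod L = Suc u mod L \<or> u mod L = Suc v mod L"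
  using assms by (auto simp: ring_graph_def doubleton_eq_iff)

text \<open>The two neighbours of \<open>v\<close> on the cycle are distinct, so by injectivity they
  lie in different blocks. Edges lead only to the preceding or the following block, so one neighbour
  is in the latter.\<close>

lemma ring_cycle_block_Suc:
  assumes "is_cycle (ring_graph L m) C" "inj_on (block L) (set C)" "v \<in> set C"
  shows "\<exists>w \<in> set C. w mod L = Suc v mod L"
proof -
  let ?l = "length C"
  have l: "3 \<le> ?l" "distinct C" using assms by (auto simp: is_cycle_def)
  have E: "{C ! i, C ! (Suc i mod ?l)} \<in> edges (ring_graph L m)" if "i < ?l" for i
    using that assms by (auto simp: is_cycle_def)
  obtain i where i: "i < ?l" "v = C ! i" using assms(3) by (auto simp: in_set_conv_nth)
  define n where "n = Suc i mod ?l"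
  define p where "p = (if i = 0 then ?l - 1 else i - 1)"
  have n: "n < ?l" unfolding n_def using l(1) by (intro mod_less_divisor) linarith
  have p: "p < ?l" "Suc p mod ?l = i" using l i by (auto simp: p_def)
  \<comment> \<open>Here the length bound 3 matters: with two vertices, successor and predecessor
    would coincide.\<close>
  have "n \<noteq> p" using l i by (auto simp: n_def p_def mod_Suc)
  then have "C ! n \<noteq> C ! p" using l n p by (simp add: nth_eq_iff_index_eq)
  then have ne: "C ! n mod L \<noteq> C ! p mod L"
    using assms(2) n p by (auto simp: block_def inj_on_def)
  have "{v, C ! n} \<in> edges (ring_graph L m)" using E[OF i(1)] i by (simp add: n_def)
  moreover have "{C ! p, v} \<in> edges (ring_graph L m)" using E[OF p(1)] p i by simp
  ultimately have "C ! n mod L = Suc v mod L \<or> C ! p mod L = Suc v mod L"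
    using ring_edge_cases Suc_mod_inject ne by metis
  then show ?thesis using n p by auto
qed

text \<open>Following successor blocks from any vertex of the cycle reaches every residue.\<close>

lemma ring_cycle_blocks:
  assumes "is_cycle (ring_graph L m) C" "inj_on (block L) (set C)" "0 < L"
  shows "bij_betw (block L) (set C) {..<L}"
proof -
  obtain v where v: "v \<in> set C" using assms(1) by (cases C) (auto simp: is_cycle_def)
  have reach: "\<exists>w \<in> set C. w mod L = (v + k) mod L" for k
  proof (induction k)
    case 0
    show ?case using v by auto
  next
    case (Suc k)
    then obtain w where w: "w \<in> set C" "w mod L = (v + k) mod L" by blast
    obtain w' where "w' \<in> set C" "w' mod L = Suc w mod L"
      using ring_cycle_block_Suc[OF assms(1,2) w(1)] by blast
    moreover have "Suc w mod L = (v + Suc k) mod L"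
      using w(2) by (metis mod_Suc_eq add_Suc_right)
    ultimately show ?case by metis
  qed
  have "i \<in> block L ` set C" if "i < L" for i
  proof -
    \<comment> \<open>\<open>L - v mod L\<close> steps lead to block 0, and \<open>i\<close> more to
      block \<open>i\<close>.\<close>
    have "v + (i + (L - v mod L)) = i + L * Suc (v div L)"
      unfolding mult_Suc_right
      using that mult_div_mod_eq[of L v] mod_less_divisor[OF assms(3), of v] by linarith
    then have "(v + (i + (L - v mod L))) mod L = i"
      using that by (simp only: mod_mult_self2 mod_less)
    then show ?thesis using reach[of "i + (L - v mod L)"] by (auto simp: block_def image_iff)
  qed
  then show ?thesis using assms by (auto simp: bij_betw_def block_def)
qed

text \<open>A block met twice contributes a factor 0; otherwise the cycle is a transversal.\<close>

lemma ring_cycle_slack_le: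
  assumes "is_cycle (ring_graph L m) C" "0 < L"
  shows "slack (block L) {..<L} (set C) \<le> 1"
proof (cases "inj_on (block L) (set C)")
  case True
  then show ?thesis using slack_transversal[OF ring_cycle_blocks[OF assms(1) _ assms(2)]] by simp
next
  case False
  then obtain x y where xy: "x \<in> set C" "y \<in> set C" "x \<noteq> y" "block L x = block L y"
    by (auto simp: inj_on_def)
  have "card {x, y} \<le> card {z \<in> set C. block L z = block L x}"
    using xy by (intro card_mono) auto
  then have "res (card {z \<in> set C. block L z = block L x}) = 0"
    using xy by (auto simp: res_def)
  moreover have "block L x \<in> {..<L}" using assms by (simp add: block_def)
  ultimately show ?thesis using slack_remove[of "{..<L}" "block L x" "block L" "set C"] by simp
qed

definition transversal :: "nat \<Rightarrow> (nat \<Rightarrow> nat) \<Rightarrow> nat list" where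
  "transversal L \<sigma> = map (\<lambda>i. i + L * \<sigma> i) [0..<L]"

lemma block_transversal: "i < L \<Longrightarrow> block L (i + L * j) = i"
  by (simp add: block_def)

lemma bij_betw_transversal: "bij_betw (block L) (set (transversal L \<sigma>)) {..<L}"
  unfolding transversal_def bij_betw_def
  by (auto simp: inj_on_def block_transversal image_image image_iff)

lemma is_cycle_transversal:
  assumes "3 \<le> L" "\<And>i. i < L \<Longrightarrow> \<sigma> i < m"
  shows "is_cycle (ring_graph L m) (transversal L \<sigma>)"
proof -
  let ?C = "transversal L \<sigma>"
  have lt: "i + L * \<sigma> i < L * m" if "i < L" for i
  proof -
    have "L * Suc (\<sigma> i) \<le> L * m" using assms(2)[OF that] by (intro mult_le_mono2) simp
    then show ?thesis using that by simp
  qed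
  have nth: "?C ! i = i + L * \<sigma> i" if "i < L" for i using that by (simp add: transversal_def)
  have len: "length ?C = L" by (simp add: transversal_def)
  have "inj_on (\<lambda>i. i + L * \<sigma> i) {..<L}"
    by (rule inj_on_inverseI[where g = "block L"]) (simp add: block_transversal)
  then have "distinct ?C" by (simp add: transversal_def distinct_map atLeast0LessThan)
  moreover have "set ?C \<subseteq> verts (ring_graph L m)"
    using lt by (auto simp: transversal_def ring_graph_def)
  moreover have "{?C ! i, ?C ! (Suc i mod L)} \<in> edges (ring_graph L m)" if "i < L" for i
  proof -
    let ?j = "Suc i mod L"
    have j: "?j < L" using assms by simp
    have "(?j + L * \<sigma> ?j) mod L = Suc (i + L * \<sigma> i) mod L"
      by (metis add_Suc mod_mult_self2 mod_mod_trivial)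
    then show ?thesis
      unfolding nth[OF that] nth[OF j] ring_graph_def snd_conv
      using lt[OF that] lt[OF j] by blast
  qed
  ultimately show ?thesis using assms(1) by (simp add: is_cycle_def len)
qed

text \<open>Extensionality makes a choice function recoverable from its values on the blocks, so
  that \<open>m ^ L\<close> transversals can be counted.\<close>

lemma inj_on_transversal:
  "inj_on (\<lambda>\<sigma>. set (transversal L \<sigma>)) ({..<L} \<rightarrow>\<^sub>E {..<m})"
proof (rule inj_onI)
  fix \<sigma> \<tau> assume \<sigma>: "\<sigma> \<in> {..<L} \<rightarrow>\<^sub>E {..<m}" and \<tau>: "\<tau> \<in> {..<L} \<rightarrow>\<^sub>E {..<m}"
    and eq: "set (transversal L \<sigma>) = set (transversal L \<tau>)"
  show "\<sigma> = \<tau>"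
  proof (rule PiE_ext[OF \<sigma> \<tau>])
    fix i assume i: "i \<in> {..<L}"
    then have "i + L * \<sigma> i \<in> set (transversal L \<tau>)"
      unfolding eq[symmetric] by (auto simp: transversal_def)
    then obtain j where j: "j < L" "i + L * \<sigma> i = j + L * \<tau> j"
      by (auto simp: transversal_def)
    then have "i = j" using i block_transversal by (metis lessThan_iff)
    with j show "\<sigma> i = \<tau> i" by simp
  qed
qed

lemma OPT_le:
  assumes "is_graph G" "is_cycle G C"
  shows "OPT G f \<le> f (set C)"
proof -
  have "{f (set C) | C. is_cycle G C} \<subseteq> f ` Pow (verts G)"
    by (auto simp: is_cycle_def)
  moreover have "finite (f ` Pow (verts G))" using assms(1) by (simp add: is_graph_def)
  ultimately have "finite {f (set C) | C. is_cycle G C}" by (rule finite_subset)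
  then show ?thesis unfolding OPT_def using assms(2) by (intro Min_le) auto
qed

text \<open>A general \<open>F\<close> serves both the plain and the hidden slack.\<close>

lemma is_instance_ring_graph:
  assumes "3 \<le> L" "0 < m"
    and "\<And>X. F X \<le> M"
    and "\<And>X Y. finite Y \<Longrightarrow> X \<subseteq> Y \<Longrightarrow> F Y \<le> F X"
    and "\<And>X Y. finite X \<Longrightarrow> finite Y \<Longrightarrow> block L ` X \<subseteq> {..<L} \<Longrightarrow> block L ` Y \<subseteq> {..<L} \<Longrightarrow>
           F X + F Y \<le> F (X \<union> Y) + F (X \<inter> Y)"
  shows "is_instance (ring_graph L m) (\<lambda>X. M - F X)"
proof -
  let ?V = "verts (ring_graph L m)"
  have sub: "finite X \<and> block L ` X \<subseteq> {..<L}" if "X \<subseteq> ?V" for X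
    using that assms(1) by (auto simp: ring_graph_def block_def intro: finite_subset)
  have "mono_on (Pow ?V) (\<lambda>X. M - F X)"
    using sub assms(4) by (intro mono_onI diff_le_mono2) auto
  moreover have "submodular_on ?V (\<lambda>X. M - F X)"
    using sub assms(3,5) by (intro submodular_on_diff) auto
  moreover have "is_cycle (ring_graph L m) (transversal L (\<lambda>_. 0))"
    using assms by (intro is_cycle_transversal) auto
  ultimately show ?thesis
    using is_graph_ring_graph[of L m] assms(1) by (auto simp: is_instance_def)
qed

section \<open>The adversary argument\<close>

text \<open>If the transversals outnumber the queries of the run on the plain function plus its
  output, one of them can be lowered unnoticed, and the unchanged output is no longer optimal. The
  bound on \<open>3 ^ L\<close> keeps the optimum linear, since all values are at most
  \<open>3 ^ L\<close>.\<close>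

lemma ring_graph_query_lower_bound:
  fixes A :: "nat algorithm"
  assumes L: "3 \<le> L" and m: "0 < m" "3 ^ L \<le> c * real (L * m)"
    and A: "solves_min_cycle A c q"
  shows "real (m ^ L) \<le> q (L * m) + 1"
proof (rule ccontr)
  assume few: "\<not> ?thesis"
  let ?G = "ring_graph L m" and ?b = "block L" and ?I = "{..<L}"
  let ?f = "\<lambda>X. 3 ^ L - slack ?b ?I X"
  let ?h = "\<lambda>S X. 3 ^ L - hidden_slack ?b ?I S X"
  have G: "is_graph ?G" using is_graph_ring_graph L by simp
  have card_G: "card (verts ?G) = L * m" by (simp add: ring_graph_def)
  have opt: "real (OPT ?G (\<lambda>X. 3 ^ L - F X)) \<le> c * real (card (verts ?G))" for F
  proof -
    have "OPT ?G (\<lambda>X. 3 ^ L - F X) \<le> 3 ^ L"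
      using OPT_le[OF G is_cycle_transversal[OF L, of "\<lambda>_. 0"], of "\<lambda>X. 3 ^ L - F X"] m
      by (meson diff_le_self le_trans)
    then have "real (OPT ?G (\<lambda>X. 3 ^ L - F X)) \<le> real (3 ^ L)" by (rule of_nat_mono)
    also have "\<dots> \<le> c * real (card (verts ?G))" using m(2) card_G by simp
    finally show ?thesis .
  qed
  have "is_instance ?G ?f"
    using slack_le[of ?b ?I]
    by (intro is_instance_ring_graph L m slack_antimono slack_supermodular) auto
  with A opt[of "slack ?b ?I"] card_G obtain k C where C: "run A ?G ?f [] k C"
    "real k \<le> q (L * m)" "is_cycle ?G C"
    unfolding solves_min_cycle_def by metis
  obtain Q where Q: "finite Q" "card Q \<le> k"
    "\<forall>f'. (\<forall>X\<in>Q. f' X = ?f X) \<longrightarrow> run A ?G f' [] k C"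
    using run_depends_on_few_values[OF C(1)] by blast
  let ?T = "(\<lambda>\<sigma>. set (transversal L \<sigma>)) ` (?I \<rightarrow>\<^sub>E {..<m})"
  \<comment> \<open>The output is one more excluded set, which accounts for the \<open>+ 1\<close>
    in the bound.\<close>
  have "card (insert (set C) Q) \<le> Suc k" using Q by (simp add: card_insert_if)
  also have "Suc k < m ^ L" using few C(2) by linarith
  also have "m ^ L = card ?T"
    by (simp add: card_image[OF inj_on_transversal] card_PiE)
  finally have "\<not> ?T \<subseteq> insert (set C) Q"
    using Q(1) card_mono[of "insert (set C) Q" ?T] by auto
  then obtain \<sigma> where \<sigma>: "\<sigma> \<in> ?I \<rightarrow>\<^sub>E {..<m}"
    "set (transversal L \<sigma>) \<noteq> set C" "set (transversal L \<sigma>) \<notin> Q"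
    by auto
  define S where "S = set (transversal L \<sigma>)"
  have S: "bij_betw ?b S ?I" "S \<noteq> set C" "S \<notin> Q"
    using \<sigma> bij_betw_transversal by (auto simp: S_def)
  have "is_instance ?G (?h S)"
    using hidden_slack_le[OF _ _ S(1)] S(1) L
    by (intro is_instance_ring_graph L m hidden_slack_antimono hidden_slack_supermodular)
      (auto simp: lessThan_empty_iff)
  with A opt[of "hidden_slack ?b ?I S"] obtain k' C' where C': "run A ?G (?h S) [] k' C'"
    "?h S (set C') \<le> OPT ?G (?h S)"
    unfolding solves_min_cycle_def by metis
  \<comment> \<open>The two functions differ only at \<open>S\<close>, which lies outside
    \<open>Q\<close>.\<close>
  have "run A ?G (?h S) [] k C"
    using S by (intro Q(3)[rule_format]) (auto simp: hidden_slack_def)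
  with C'(1) have "C' = C" using run_deterministic by blast
  with C'(2) have "?h S (set C) \<le> ?h S S"
    using OPT_le[OF G is_cycle_transversal[OF L, of \<sigma> m], of "?h S"] \<sigma>(1)
    by (auto simp: S_def PiE_iff intro: le_trans)
  moreover have "?h S S = 3 ^ L - 2"
    using slack_transversal[OF S(1)] by (simp add: hidden_slack_def numeral_2_eq_2)
  moreover have "?h S (set C) \<ge> 3 ^ L - 1"
    using ring_cycle_slack_le[OF C(3)] L S(2) by (auto simp: hidden_slack_def)
  \<comment> \<open>Keeps the truncated \<open>3 ^ L - 2\<close> strictly below
    \<open>3 ^ L - 1\<close>.\<close>
  moreover have "(3::nat) ^ 1 \<le> 3 ^ L" using L by (intro power_increasing) auto
  ultimately show False by simp
qed

section \<open>Asymptotic comparison\<close>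

theorem theorem5:
  "\<exists>c::real. c > 0 \<and>
     \<not> (\<exists>(A :: nat algorithm) (g :: nat \<Rightarrow> real).
           g \<in> o(\<lambda>n. ln (real n)) \<and>
           solves_min_cycle A c (\<lambda>n. real n powr g n))"
proof (intro exI[of _ 1] conjI notI)
  assume "\<exists>(A :: nat algorithm) (g :: nat \<Rightarrow> real). g \<in> o(\<lambda>n. ln (real n)) \<and>
           solves_min_cycle A 1 (\<lambda>n. real n powr g n)"
  then obtain A :: "nat algorithm" and g :: "nat \<Rightarrow> real" where
    g: "g \<in> o(\<lambda>n. ln (real n))" and A: "solves_min_cycle A 1 (\<lambda>n. real n powr g n)" by blast
  \<comment> \<open>Chosen so that \<open>ln n \<le> 2 * L * ln 3\<close> bounds
    \<open>\<epsilon> * ln n * ln n\<close> by half the logarithm of the number of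
    transversals.\<close>
  define \<epsilon> :: real where "\<epsilon> = 1 / (8 * ln 3)"
  have "\<epsilon> > 0" by (simp add: \<epsilon>_def)
  with g have "\<forall>\<^sub>F n in sequentially. norm (g n) \<le> \<epsilon> * norm (ln (real n))"
    by (rule landau_o.smallD)
  then obtain N where N: "\<And>n. N \<le> n \<Longrightarrow> norm (g n) \<le> \<epsilon> * norm (ln (real n))"
    by (auto simp: eventually_sequentially)
  define L where "L = max N 3"
  \<comment> \<open>Each block has \<open>m = 3 ^ L\<close> vertices, so all function values are at
    most \<open>n\<close> and \<open>c = 1\<close> suffices, while \<open>ln n\<close> stays linear
    in \<open>L\<close>.\<close>
  define n where "n = L * 3 ^ L"
  have L: "3 \<le> L" "N \<le> L" by (auto simp: L_def)
  have "L * 1 \<le> n" unfolding n_def by (intro mult_le_mono2) simp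
  then have n: "N \<le> n" "1 \<le> n" using L by auto
  have "L < 3 ^ L" by (rule less_exp[THEN less_le_trans]) (simp add: power_mono)
  then have "n \<le> 3 ^ L * 3 ^ L" unfolding n_def by (intro mult_le_mono1) simp
  then have "real n \<le> 3 ^ (2 * L)"
    by (metis mult_2 of_nat_le_iff of_nat_numeral of_nat_power power_add)
  then have "ln (real n) \<le> ln (3 ^ (2 * L))" using n by (intro ln_mono) auto
  then have ln_n: "ln (real n) \<le> 2 * L * ln 3" by (simp add: ln_realpow)
  have ln_pos: "0 \<le> ln (real n)" using n by simp
  have "real n powr g n = exp (g n * ln (real n))" using n by (simp add: powr_def)
  also have "g n * ln (real n) \<le> \<epsilon> * ln (real n) * ln (real n)"
    using N[OF n(1)] ln_pos by (intro mult_right_mono) auto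
  also have "\<dots> \<le> \<epsilon> * (2 * L * ln 3) * (2 * L * ln 3)"
    using ln_n ln_pos \<open>\<epsilon> > 0\<close> by (intro mult_mono) auto
  also have "\<dots> = real (L * L) * ln 3 / 2" by (simp add: \<epsilon>_def field_simps)
  finally have q: "real n powr g n \<le> exp (real (L * L) * ln 3 / 2)" by simp
  \<comment> \<open>The square root of the number of transversals; \<open>x * x \<le> x + 1\<close>
    fails once \<open>2 \<le> x\<close>.\<close>
  define x where "x = exp (real (L * L) * ln 3 / 2)"
  have "real ((3 ^ L) ^ L) \<le> real n powr g n + 1"
    unfolding n_def
    by (rule ring_graph_query_lower_bound[OF L(1) _ _ A]) (use L in \<open>auto simp: mult_le_cancel_right1\<close>)
  also have "\<dots> \<le> x + 1" using q by (simp add: x_def)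
  finally have "real ((3 ^ L) ^ L) \<le> x + 1" .
  moreover have "x * x = real ((3 ^ L) ^ L)"
  proof -
    have "x * x = exp (real (L * L) * ln 3)" by (simp add: x_def flip: exp_add)
    also have "\<dots> = 3 ^ (L * L)" by (simp only: exp_of_nat_mult exp_ln zero_less_numeral)
    finally show ?thesis by (simp add: power_mult)
  qed
  moreover have "2 \<le> x"
  proof -
    have "(1::real) \<le> ln 3" using exp_le by (simp add: ln_ge_iff)
    moreover have "3 * 3 \<le> real (L * L)" using L by (simp only: of_nat_mult) (intro mult_mono, auto)
    ultimately have "3 * 3 * 1 \<le> real (L * L) * ln 3" by (intro mult_mono) auto
    then have "1 + 1 \<le> 1 + real (L * L) * ln 3 / 2" by simp
    also have "\<dots> \<le> x" unfolding x_def by (rule exp_ge_add_one_self)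
    finally show ?thesis by simp
  qed
  then have "2 * x \<le> x * x" by (intro mult_right_mono) auto
  ultimately show False using \<open>2 \<le> x\<close> by linarith
qed simp

end
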